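(* Let $\underline{P}\succeq0$ be such that, for every $i\in\mathbb{M}$, $$\begin{bmatrix}A_i^\top\underline{P}A_i-\underline{P}+Q_i & A_i^\top\underline{P}B_i\\ B_i^\top\underline{P}A_i & R_i+B_i^\top\underline{P}B_i\end{bmatrix}\succeq0,$$ and suppose there is a real matrix $\overline{P}\succ0$ such that, for every $x\in\mathbb{R}^{n_x}$, there exist infinite input sequences $\bm{u}(x),\bm{i}(x)$ with $V^\star(x)=J(x,\bm{u}(x),\bm{i}(x))\le x^\top\overline{P}x$. Let $\alpha\in(0,1)$ and $\alpha_0>0$ satisfy, for all $i\in\mathbb{M}$, $$\alpha\overline{P}\preceq Q_i,\qquad \alpha_0(\overline{P}-\underline{P})\preceq Q_i.$$ Then, for any integer $d>1$ and any $x\in\mathbb{R}^{n_x}$, $$V^\star(x)-V_d^\star(x)\le\frac{1}{\alpha_0}(1-\alpha)^{d-1}\,x^\top\overline{P}x.$$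
   Context: Matrix inequalities: $A\succeq 0$ (resp. $A\succ0$) means $A$ is real, symmetric and positive semi-definite (resp. positive definite); $A\preceq B$ means $B-A\succeq0$. System: $x^+=A_ix+B_iu$ with state $x\in\mathbb{R}^{n_x}$, continuous input $u\in\mathbb{R}^{n_u}$, discrete input $i\in\mathbb{M}:=\{1,\dots,M\}$, $n_x,n_u,M\in\mathbb{Z}_{>0}$. The matrices $A_i,B_i,Q_i,R_i$ are real of conformable dimensions, and $Q_i\succ0$, $R_i\succ0$ for all $i\in\mathbb{M}$. Stage cost: $\ell(x,u,i):=x^\top Q_ix+u^\top R_iu$. For input sequences $\bm{u}=(u_0,u_1,\dots)$ and $\bm{i}=(i_0,i_1,\dots)$, the solution is $\phi(0,x,\bm{u},\bm{i})=x$, $\phi(k+1,x,\bm{u},\bm{i})=A_{i_k}\phi(k,x,\bm{u},\bm{i})+B_{i_k}u_k$. Infinite-horizon cost, for infinite sequences $\bm{u},\bm{i}$: $J(x,\bm{u},\bm{i}):=\sum_{k=0}^\infty\ell(\phi(k,x,\bm{u},\bm{i}),u_k,i_k)$, with optimal value $V^\star(x):=\min_{\bm{u},\bm{i}}J(x,\bm{u},\bm{i})$. Finite-horizon cost: with $J_0(x):=x^\top\underline{P}x$, for $d\in\mathbb{Z}_{\ge0}$ and sequences $\bm{u},\bm{i}$ of length $d$, $$J_d(x,\bm{u},\bm{i}):=\sum_{k=0}^{d-1}\ell(\phi(k,x,\bm{u},\bm{i}),u_k,i_k)+J_0(\phi(d,x,\bm{u},\bm{i})),$$ $V_d^\circ(x,\bm{i}):=\min_{\bm{u}}J_d(x,\bm{u},\bm{i})$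 (minimum over $\bm{u}\in(\mathbb{R}^{n_u})^d$), and $V_d^\star(x):=\min_{\bm{i}\in\mathbb{M}^d}V_d^\circ(x,\bm{i})$, with $V_0^\star=J_0$. *)

theory Defs
  imports "HOL-Analysis.Analysis"
begin

text \<open>
  State and input space are \<open>real ^ 'n\<close> and \<open>real ^ 'm\<close>; the discrete inputs are
  \<open>{1..M}\<close>, and families such as \<open>A\<close>, \<open>B\<close>, \<open>Q\<close>, \<open>R\<close> are indexed by \<open>nat\<close>, of which only
  the members with index in \<open>{1..M}\<close> are relevant.
\<close>

definition psd :: "real ^ 'n ^ 'n \<Rightarrow> bool" where
  "psd A \<longleftrightarrow> transpose A = A \<and> (\<forall>x. 0 \<le> x \<bullet> (A *v x))"

definition pd :: "real ^ 'n ^ 'n \<Rightarrow> bool" where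
  "pd A \<longleftrightarrow> transpose A = A \<and> (\<forall>x. x \<noteq> 0 \<longrightarrow> 0 < x \<bullet> (A *v x))"

definition loewner_le :: "real ^ 'n ^ 'n \<Rightarrow> real ^ 'n ^ 'n \<Rightarrow> bool"  (infix "\<preceq>" 50) where
  "A \<preceq> B \<longleftrightarrow> psd (B - A)"

definition block_matrix ::
  "real ^ 'c ^ 'a \<Rightarrow> real ^ 'd ^ 'a \<Rightarrow> real ^ 'c ^ 'b \<Rightarrow> real ^ 'd ^ 'b
    \<Rightarrow> real ^ ('c + 'd) ^ ('a + 'b)" where
  "block_matrix E F G H =
    (\<chi> p q. case p of
       Inl a \<Rightarrow> (case q of Inl c \<Rightarrow> E $ a $ c | Inr d \<Rightarrow> F $ a $ d)
     | Inr b \<Rightarrow> (case q of Inl c \<Rightarrow> G $ b $ c | Inr d \<Rightarrow> H $ b $ d))"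

definition stage_cost ::
  "(nat \<Rightarrow> real ^ 'n ^ 'n) \<Rightarrow> (nat \<Rightarrow> real ^ 'm ^ 'm) \<Rightarrow> real ^ 'n \<Rightarrow> real ^ 'm \<Rightarrow> nat \<Rightarrow> real" where
  "stage_cost Q R x u i = x \<bullet> (Q i *v x) + u \<bullet> (R i *v u)"

fun sol ::
  "(nat \<Rightarrow> real ^ 'n ^ 'n) \<Rightarrow> (nat \<Rightarrow> real ^ 'm ^ 'n) \<Rightarrow>
    nat \<Rightarrow> real ^ 'n \<Rightarrow> (nat \<Rightarrow> real ^ 'm) \<Rightarrow> (nat \<Rightarrow> nat) \<Rightarrow> real ^ 'n" where
  "sol A B 0 x u i = x"
| "sol A B (Suc k) x u i = A (i k) *v sol A B k x u i + B (i k) *v u k"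

text \<open>
  The infinite-horizon cost may be infinite, hence takes values in \<^typ>\<open>ereal\<close>.
\<close>

definition J_inf ::
  "(nat \<Rightarrow> real ^ 'n ^ 'n) \<Rightarrow> (nat \<Rightarrow> real ^ 'm ^ 'n) \<Rightarrow>
    (nat \<Rightarrow> real ^ 'n ^ 'n) \<Rightarrow> (nat \<Rightarrow> real ^ 'm ^ 'm) \<Rightarrow>
    real ^ 'n \<Rightarrow> (nat \<Rightarrow> real ^ 'm) \<Rightarrow> (nat \<Rightarrow> nat) \<Rightarrow> ereal" where
  "J_inf A B Q R x u i = (\<Sum>k. ereal (stage_cost Q R (sol A B k x u i) (u k) (i k)))"

text \<open>
  An infimum; that it is a minimum has to be assumed where it is needed.
\<close>

definition V_inf ::
  "nat \<Rightarrow> (nat \<Rightarrow> real ^ 'n ^ 'n) \<Rightarrow> (nat \<Rightarrow> real ^ 'm ^ 'n) \<Rightarrow>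
    (nat \<Rightarrow> real ^ 'n ^ 'n) \<Rightarrow> (nat \<Rightarrow> real ^ 'm ^ 'm) \<Rightarrow> real ^ 'n \<Rightarrow> ereal" where
  "V_inf M A B Q R x =
    (INF (u, i) \<in> UNIV \<times> (UNIV \<rightarrow> {1..M}). J_inf A B Q R x u i)"

definition J_fin ::
  "(nat \<Rightarrow> real ^ 'n ^ 'n) \<Rightarrow> (nat \<Rightarrow> real ^ 'm ^ 'n) \<Rightarrow>
    (nat \<Rightarrow> real ^ 'n ^ 'n) \<Rightarrow> (nat \<Rightarrow> real ^ 'm ^ 'm) \<Rightarrow> real ^ 'n ^ 'n \<Rightarrow>
    nat \<Rightarrow> real ^ 'n \<Rightarrow> (nat \<Rightarrow> real ^ 'm) \<Rightarrow> (nat \<Rightarrow> nat) \<Rightarrow> real" where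
  "J_fin A B Q R P d x u i =
    (\<Sum>k<d. stage_cost Q R (sol A B k x u i) (u k) (i k))
      + sol A B d x u i \<bullet> (P *v sol A B d x u i)"

text \<open>
  Sequences of length \<open>d\<close> are extensional functions on \<open>{..<d}\<close>. The infimum below is a
  minimum in the setting of interest, see lemma \<open>V_circ_attained\<close>.
\<close>

definition V_circ ::
  "(nat \<Rightarrow> real ^ 'n ^ 'n) \<Rightarrow> (nat \<Rightarrow> real ^ 'm ^ 'n) \<Rightarrow>
    (nat \<Rightarrow> real ^ 'n ^ 'n) \<Rightarrow> (nat \<Rightarrow> real ^ 'm ^ 'm) \<Rightarrow> real ^ 'n ^ 'n \<Rightarrow>
    nat \<Rightarrow> real ^ 'n \<Rightarrow> (nat \<Rightarrow> nat) \<Rightarrow> real" where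
  "V_circ A B Q R P d x i = (INF u \<in> {..<d} \<rightarrow>\<^sub>E UNIV. J_fin A B Q R P d x u i)"

definition V_fin ::
  "nat \<Rightarrow> (nat \<Rightarrow> real ^ 'n ^ 'n) \<Rightarrow> (nat \<Rightarrow> real ^ 'm ^ 'n) \<Rightarrow>
    (nat \<Rightarrow> real ^ 'n ^ 'n) \<Rightarrow> (nat \<Rightarrow> real ^ 'm ^ 'm) \<Rightarrow> real ^ 'n ^ 'n \<Rightarrow>
    nat \<Rightarrow> real ^ 'n \<Rightarrow> real" where
  "V_fin M A B Q R P d x = (MIN i \<in> {..<d} \<rightarrow>\<^sub>E {1..M}. V_circ A B Q R P d x i)"

lemma V_fin_0: "V_fin M A B Q R P 0 x = x \<bullet> (P *v x)"
  by (simp add: V_fin_def V_circ_def J_fin_def)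

lemma pd_lower_bound:
  fixes R :: "real ^ 'm ^ 'm"
  assumes "pd R"
  obtains c where "c > 0" "\<And>u. c * (norm u)\<^sup>2 \<le> u \<bullet> (R *v u)"
proof -
  have cont: "continuous_on (sphere 0 1) (\<lambda>u. u \<bullet> (R *v u))"
    by (intro continuous_intros matrix_vector_mult_linear_continuous_on)
  have "axis undefined 1 \<in> sphere (0 :: real ^ 'm) 1" by simp
  then have "sphere (0 :: real ^ 'm) 1 \<noteq> {}" by blast
  then obtain v where v: "v \<in> sphere 0 1"
      "\<And>u. u \<in> sphere 0 1 \<Longrightarrow> v \<bullet> (R *v v) \<le> u \<bullet> (R *v u)"
    using continuous_attains_inf[OF compact_sphere _ cont] by blast
  show thesis
  proof
    from v(1) have "v \<noteq> 0" by auto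
    then show "v \<bullet> (R *v v) > 0" using assms by (simp add: pd_def)
    fix u :: "real ^ 'm"
    show "v \<bullet> (R *v v) * (norm u)\<^sup>2 \<le> u \<bullet> (R *v u)"
    proof (cases "u = 0")
      case False
      define w where "w = (1 / norm u) *\<^sub>R u"
      have "w \<in> sphere 0 1" using False by (simp add: w_def)
      then have "v \<bullet> (R *v v) \<le> w \<bullet> (R *v w)" by (rule v(2))
      moreover have "u \<bullet> (R *v u) = (norm u)\<^sup>2 * (w \<bullet> (R *v w))"
        using False by (simp add: w_def matrix_vector_mult_scaleR power2_eq_square)
      ultimately show ?thesis by (metis mult.commute mult_left_mono zero_le_power2)
    qed simp
  qed
qed

lemma continuous_on_sol: "continuous_on UNIV (\<lambda>u. sol A B k x u i)"
proof (induction k)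
  case (Suc k)
  have "continuous_on UNIV (\<lambda>u :: nat \<Rightarrow> real ^ 'a. u k)"
    by (rule continuous_on_product_coordinates)
  then have "continuous_on UNIV (\<lambda>u. B (i k) *v u k)"
    by (rule continuous_on_compose2[OF matrix_vector_mult_linear_continuous_on[of UNIV]]) simp
  moreover have "continuous_on UNIV (\<lambda>u. A (i k) *v sol A B k x u i)"
    using Suc
    by (rule continuous_on_compose2[OF matrix_vector_mult_linear_continuous_on[of UNIV]]) simp
  ultimately show ?case by (simp add: continuous_on_add)
qed simp

lemma continuous_on_quadratic:
  fixes P :: "real ^ 'n ^ 'n"
  assumes "continuous_on S f"
  shows "continuous_on S (\<lambda>u. f u \<bullet> (P *v f u))"
proof -
  have "continuous_on S (\<lambda>u. P *v f u)"
    using assms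
    by (rule continuous_on_compose2[OF matrix_vector_mult_linear_continuous_on[of UNIV]]) simp
  then show ?thesis using assms by (intro continuous_on_inner)
qed

lemma continuous_on_J_fin: "continuous_on UNIV (\<lambda>u. J_fin A B Q R P d x u i)"
  unfolding J_fin_def stage_cost_def
  by (intro continuous_intros continuous_on_quadratic continuous_on_sol
      continuous_on_product_coordinates)

lemma V_circ_attained:
  fixes A :: "nat \<Rightarrow> real ^ 'n ^ 'n" and B :: "nat \<Rightarrow> real ^ 'm ^ 'n"
  assumes Q: "\<And>k. k < d \<Longrightarrow> pd (Q (i k))" and R: "\<And>k. k < d \<Longrightarrow> pd (R (i k))" and P: "psd P"
  shows "\<exists>u \<in> {..<d} \<rightarrow>\<^sub>E UNIV. V_circ A B Q R P d x i = J_fin A B Q R P d x u i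
    \<and> (\<forall>v. J_fin A B Q R P d x u i \<le> J_fin A B Q R P d x v i)"
proof -
  let ?J = "\<lambda>u. J_fin A B Q R P d x u i"
  have nonneg: "0 \<le> v \<bullet> (S *v v)" if "pd S" for v and S :: "real ^ 'k ^ 'k"
    using that by (cases "v = 0") (auto simp: pd_def less_imp_le)
  have "\<exists>c. \<forall>k. k < d \<longrightarrow> c k > 0 \<and> (\<forall>u. c k * (norm u)\<^sup>2 \<le> u \<bullet> (R (i k) *v u))"
    using R by (intro choice) (metis pd_lower_bound)
  then obtain c where c: "\<And>k. k < d \<Longrightarrow> c k > 0"
      "\<And>k u. k < d \<Longrightarrow> c k * (norm u)\<^sup>2 \<le> u \<bullet> (R (i k) *v u)"
    by blast
  define z :: "nat \<Rightarrow> real ^ 'm" where "z = restrict (\<lambda>_. 0) {..<d}"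
  define r where "r k = sqrt (?J z / c k)" for k
  define K where "K = PiE UNIV (\<lambda>k. if k < d then cball (0 :: real ^ 'm) (r k) else {undefined})"
  have bound: "c k * (norm (u k))\<^sup>2 \<le> ?J u" if "k < d" for u k
  proof -
    have "c k * (norm (u k))\<^sup>2 \<le> stage_cost Q R (sol A B k x u i) (u k) (i k)"
      using c(2)[OF that, of "u k"] nonneg[OF Q[OF that]] by (simp add: stage_cost_def add_increasing)
    also have "\<dots> \<le> (\<Sum>k<d. stage_cost Q R (sol A B k x u i) (u k) (i k))"
      by (rule member_le_sum) (use that nonneg[OF Q] nonneg[OF R] in \<open>auto simp: stage_cost_def\<close>)
    also have "\<dots> \<le> ?J u" using P by (simp add: J_fin_def psd_def)
    finally show ?thesis .
  qed
  have in_K: "u \<in> K" if u: "u \<in> {..<d} \<rightarrow>\<^sub>E UNIV" and le: "?J u \<le> ?J z" for u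
    unfolding K_def
  proof (rule PiE_I)
    fix k
    show "u k \<in> (if k < d then cball 0 (r k) else {undefined})"
    proof (cases "k < d")
      case True
      have "(norm (u k))\<^sup>2 \<le> ?J z / c k"
        using bound[OF True, of u] le c(1)[OF True] by (simp add: field_simps)
      then have "norm (u k) \<le> r k" unfolding r_def by (rule real_le_rsqrt)
      then show ?thesis using True by simp
    next
      case False
      then show ?thesis using u by (auto simp: PiE_def extensional_def)
    qed
  qed simp
  have z: "z \<in> {..<d} \<rightarrow>\<^sub>E UNIV" by (auto simp: z_def)
  have "compactin (product_topology (\<lambda>_. euclidean) UNIV) K"
    unfolding K_def compactin_PiE by simp
  then have "compact K" by (simp add: euclidean_product_topology)
  moreover have "K \<noteq> {}" using in_K[OF z] by auto
  moreover have "continuous_on K ?J"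
    using continuous_on_J_fin by (rule continuous_on_subset) simp
  ultimately have "\<exists>u\<in>K. \<forall>v\<in>K. ?J u \<le> ?J v"
    by (rule continuous_attains_inf)
  then obtain u where u: "u \<in> K" "\<And>v. v \<in> K \<Longrightarrow> ?J u \<le> ?J v"
    by blast
  have ext: "u \<in> {..<d} \<rightarrow>\<^sub>E UNIV"
  proof (rule PiE_I)
    fix k
    assume "k \<notin> {..<d}"
    moreover have "u k \<in> (if k < d then cball 0 (r k) else {undefined})"
      using u(1) unfolding K_def by (rule PiE_mem) simp
    ultimately show "u k = undefined" by simp
  qed simp
  have min: "?J u \<le> ?J v" if "v \<in> {..<d} \<rightarrow>\<^sub>E UNIV" for v
  proof (cases "?J v \<le> ?J z")
    case True
    then show ?thesis by (intro u(2) in_K that)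
  next
    case False
    moreover have "?J u \<le> ?J z" by (intro u(2) in_K z order_refl)
    ultimately show ?thesis by linarith
  qed
  have sol_restrict: "sol A B k x (restrict v {..<d}) i = sol A B k x v i" if "k \<le> d" for v k
    using that by (induction k) auto
  have J_restrict: "?J (restrict v {..<d}) = ?J v" for v
    by (simp add: J_fin_def sol_restrict)
  have "?J u \<le> ?J v" for v
    using min[of "restrict v {..<d}"] by (simp add: J_restrict)
  moreover have "V_circ A B Q R P d x i = ?J u"
    unfolding V_circ_def using ext min by (intro cInf_eq_minimum) auto
  ultimately show ?thesis using ext by blast
qed

end

theory Submission
  imports Defs
begin

text \<open>
  Take inputs that are optimal for horizon \<open>d\<close>, let \<open>x\<^sub>k\<close> be the resulting states, \<open>\<ell>\<^sub>k\<close> the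
  stage costs, and let \<open>T\<^sub>k\<close> be the part of the optimal cost that is incurred from time \<open>k\<close>
  on, so that \<open>T\<^sub>k = \<ell>\<^sub>k + T\<^sub>k\<^sub>+\<^sub>1\<close>.

  The block matrix inequality is a dissipation inequality for the terminal cost
  (\<open>block_psd_dissipation\<close>): following any input, the accumulated cost plus the terminal cost
  of the current state never decreases. Two consequences are used. First, every finite-horizon
  optimal value is at most the infinite-horizon one (\<open>J_fin_le_cost_bound\<close>), because along an input
  of finite cost the state, and with it the terminal cost, tends to zero. By optimality
  of tails this gives \<open>T\<^sub>k \<le> V\<^sup>\<star> x\<^sub>k \<le> x\<^sub>k \<bullet> P_up x\<^sub>k\<close>, and \<open>\<alpha> P_up \<preceq> Q\<close> then yields
  \<open>\<alpha> T\<^sub>k \<le> \<ell>\<^sub>k\<close>. Hence \<open>T\<^sub>k\<^sub>+\<^sub>1 \<le> (1 - \<alpha>) T\<^sub>k\<close>, that is, the tail of the cost decays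
  geometrically (\<open>tail_cost_decay\<close>). Second, \<open>x\<^sub>k \<bullet> P_low x\<^sub>k \<le> T\<^sub>k\<close>.

  Finally, follow the optimal inputs for \<open>d - 1\<close> steps only and then switch to inputs that are
  optimal for the infinite horizon. The cost of this strategy bounds \<open>V\<^sup>\<star> x\<close>, so that the gap
  between the two values is at most
  \<open>x\<^sub>d\<^sub>-\<^sub>1 \<bullet> P_up x\<^sub>d\<^sub>-\<^sub>1 - T\<^sub>d\<^sub>-\<^sub>1 \<le> x\<^sub>d\<^sub>-\<^sub>1 \<bullet> (P_up - P_low) x\<^sub>d\<^sub>-\<^sub>1 \<le> \<ell>\<^sub>d\<^sub>-\<^sub>1 / \<alpha>\<^sub>0 \<le> T\<^sub>d\<^sub>-\<^sub>1 / \<alpha>\<^sub>0\<close>,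
  which the decay of the tail bounds as claimed. Stopping one step before the end
  is what makes the state cost at \<open>x\<^sub>d\<^sub>-\<^sub>1\<close> part of the tail.
\<close>

section \<open>Concatenation of inputs\<close>

definition concat_seq :: "nat \<Rightarrow> (nat \<Rightarrow> 'a) \<Rightarrow> (nat \<Rightarrow> 'a) \<Rightarrow> nat \<Rightarrow> 'a" where
  "concat_seq n f g k = (if k < n then f k else g (k - n))"

lemma concat_seq_less [simp]: "k < n \<Longrightarrow> concat_seq n f g k = f k"
  and concat_seq_add [simp]: "concat_seq n f g (n + k) = g k"
  by (simp_all add: concat_seq_def)

lemma sol_cong:
  assumes "\<And>l. l < k \<Longrightarrow> u l = v l" and "\<And>l. l < k \<Longrightarrow> i l = j l"
  shows "sol A B k x u i = sol A B k x v j"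
  using assms by (induction k) auto

lemma sol_add:
  "sol A B (n + k) x u i = sol A B k (sol A B n x u i) (\<lambda>l. u (n + l)) (\<lambda>l. i (n + l))"
  by (induction k) simp_all

text \<open>
  This is \<^const>\<open>J_fin\<close> without its terminal cost; its values for all \<open>n\<close> are the partial sums
  of \<^const>\<open>J_inf\<close>.
\<close>

definition running_cost ::
  "(nat \<Rightarrow> real ^ 'n ^ 'n) \<Rightarrow> (nat \<Rightarrow> real ^ 'm ^ 'n) \<Rightarrow>
    (nat \<Rightarrow> real ^ 'n ^ 'n) \<Rightarrow> (nat \<Rightarrow> real ^ 'm ^ 'm) \<Rightarrow>
    nat \<Rightarrow> real ^ 'n \<Rightarrow> (nat \<Rightarrow> real ^ 'm) \<Rightarrow> (nat \<Rightarrow> nat) \<Rightarrow> real" where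
  "running_cost A B Q R n x u i = (\<Sum>k<n. stage_cost Q R (sol A B k x u i) (u k) (i k))"

lemma J_fin_running_cost:
  "J_fin A B Q R P d x u i =
    running_cost A B Q R d x u i + sol A B d x u i \<bullet> (P *v sol A B d x u i)"
  by (simp add: J_fin_def running_cost_def)

lemma running_cost_cong:
  assumes "\<And>l. l < n \<Longrightarrow> u l = v l" and "\<And>l. l < n \<Longrightarrow> i l = j l"
  shows "running_cost A B Q R n x u i = running_cost A B Q R n x v j"
proof -
  have "sol A B k x u i = sol A B k x v j" if "k < n" for k
    by (rule sol_cong) (use assms that in auto)
  then show ?thesis
    unfolding running_cost_def by (intro sum.cong) (use assms in auto)
qed

lemma running_cost_add:
  "running_cost A B Q R (n + k) x u i = running_cost A B Q R n x u i
    + running_cost A B Q R k (sol A B n x u i) (\<lambda>l. u (n + l)) (\<lambda>l. i (n + l))"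
  by (induction k) (simp_all add: running_cost_def sol_add)

lemma J_fin_cong:
  assumes "\<And>l. l < d \<Longrightarrow> u l = v l" and "\<And>l. l < d \<Longrightarrow> i l = j l"
  shows "J_fin A B Q R P d x u i = J_fin A B Q R P d x v j"
  using assms
  by (simp add: J_fin_running_cost cong: sol_cong running_cost_cong)

lemma J_fin_add:
  "J_fin A B Q R P (n + d) x u i = running_cost A B Q R n x u i
    + J_fin A B Q R P d (sol A B n x u i) (\<lambda>l. u (n + l)) (\<lambda>l. i (n + l))"
  by (simp add: J_fin_running_cost running_cost_add sol_add)

lemma running_cost_concat:
  "running_cost A B Q R (n + k) x (concat_seq n u v) (concat_seq n i j) =
    running_cost A B Q R n x u i + running_cost A B Q R k (sol A B n x u i) v j"
proof -
  have "sol A B n x (concat_seq n u v) (concat_seq n i j) = sol A B n x u i"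
    by (rule sol_cong) auto
  moreover have "running_cost A B Q R n x (concat_seq n u v) (concat_seq n i j) =
      running_cost A B Q R n x u i"
    by (rule running_cost_cong) auto
  ultimately show ?thesis by (simp add: running_cost_add)
qed

lemma J_fin_concat:
  "J_fin A B Q R P (n + d) x (concat_seq n u v) (concat_seq n i j) =
    running_cost A B Q R n x u i + J_fin A B Q R P d (sol A B n x u i) v j"
proof -
  have "sol A B n x (concat_seq n u v) (concat_seq n i j) = sol A B n x u i"
    by (rule sol_cong) auto
  then show ?thesis
    by (simp add: J_fin_running_cost running_cost_concat sol_add)
qed

section \<open>Quadratic forms and matrix inequalities\<close>

lemma pd_nonneg: "pd S \<Longrightarrow> 0 \<le> v \<bullet> (S *v v)"
  by (cases "v = 0") (auto simp: pd_def less_imp_le)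

lemma loewner_leD: "S \<preceq> T \<Longrightarrow> v \<bullet> (S *v v) \<le> v \<bullet> (T *v v)"
  by (simp add: loewner_le_def psd_def matrix_vector_mult_diff_rdistrib inner_diff_right)

lemma block_matrix_quadratic_form:
  fixes E :: "real ^ 'a ^ 'a" and F :: "real ^ 'b ^ 'a"
    and G :: "real ^ 'a ^ 'b" and H :: "real ^ 'b ^ 'b"
  defines "z \<equiv> \<lambda>y u. \<chi> p. case p of Inl a \<Rightarrow> y $ a | Inr b \<Rightarrow> u $ b"
  shows "z y u \<bullet> (block_matrix E F G H *v z y u) =
    y \<bullet> (E *v y) + y \<bullet> (F *v u) + u \<bullet> (G *v y) + u \<bullet> (H *v u)"
proof -
  have sum_UNIV: "sum f UNIV = (\<Sum>a\<in>UNIV. f (Inl a)) + (\<Sum>b\<in>UNIV. f (Inr b))"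
    for f :: "'a + 'b \<Rightarrow> real"
    using sum.Plus[of UNIV UNIV f] by (simp add: comp_def)
  show ?thesis
    by (simp add: z_def block_matrix_def inner_vec_def matrix_vector_mult_def sum_UNIV
        sum.distrib ring_distribs)
qed

lemma inner_transpose_mult:
  fixes S :: "real ^ 'b ^ 'c"
  shows "y \<bullet> (transpose S ** T ** U *v w) = (S *v y) \<bullet> (T *v (U *v w))"
  by (metis dot_lmul_matrix inner_commute matrix_vector_mul_assoc transpose_matrix_vector
      transpose_transpose)

text \<open>
  The quadratic form of the block matrix at the pair \<open>(y, u)\<close> is exactly the difference of the
  two sides.
\<close>

lemma block_psd_dissipation:
  fixes A :: "nat \<Rightarrow> real ^ 'n ^ 'n" and B :: "nat \<Rightarrow> real ^ 'm ^ 'n"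
  assumes "psd (block_matrix
      (transpose (A i) ** P ** A i - P + Q i)  (transpose (A i) ** P ** B i)
      (transpose (B i) ** P ** A i)  (R i + transpose (B i) ** P ** B i))"
  shows "y \<bullet> (P *v y) \<le>
    stage_cost Q R y u i + (A i *v y + B i *v u) \<bullet> (P *v (A i *v y + B i *v u))"
proof -
  let ?z = "\<chi> p. case p of Inl a \<Rightarrow> y $ a | Inr b \<Rightarrow> u $ b"
  have "0 \<le> ?z \<bullet> (block_matrix
      (transpose (A i) ** P ** A i - P + Q i)  (transpose (A i) ** P ** B i)
      (transpose (B i) ** P ** A i)  (R i + transpose (B i) ** P ** B i) *v ?z)"
    using assms unfolding psd_def by blast
  then show ?thesis
    unfolding block_matrix_quadratic_form
    by (simp add: stage_cost_def matrix_vector_mult_diff_rdistrib matrix_vector_mult_add_rdistrib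
        matrix_vector_right_distrib inner_transpose_mult inner_add_left inner_add_right
        inner_diff_right)
qed

section \<open>Attainment of the finite-horizon value\<close>

text \<open>
  The discrete inputs range over a finite set, so attainment for each of them suffices. The
  minimiser beats all sequences, not only the extensional ones, because the cost depends on the
  first \<open>d\<close> entries alone.
\<close>

lemma V_fin_attained:
  fixes A :: "nat \<Rightarrow> real ^ 'n ^ 'n" and B :: "nat \<Rightarrow> real ^ 'm ^ 'n"
  assumes M: "M > 0" and Q: "\<And>i. i \<in> {1..M} \<Longrightarrow> pd (Q i)"
    and R: "\<And>i. i \<in> {1..M} \<Longrightarrow> pd (R i)" and P: "psd P"
  obtains u i where "i \<in> {..<d} \<rightarrow> {1..M}" and "V_fin M A B Q R P d x = J_fin A B Q R P d x u i"
    and "\<And>v j. j \<in> {..<d} \<rightarrow> {1..M} \<Longrightarrow> J_fin A B Q R P d x u i \<le> J_fin A B Q R P d x v j"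
proof -
  let ?I = "{..<d} \<rightarrow>\<^sub>E {1..M}" and ?V = "V_circ A B Q R P d x"
  have fin: "finite (?V ` ?I)" by (simp add: finite_PiE)
  moreover have "?V ` ?I \<noteq> {}" using M by (simp add: PiE_eq_empty_iff)
  ultimately have "Min (?V ` ?I) \<in> ?V ` ?I" by (rule Min_in)
  then obtain i where i: "i \<in> ?I" "Min (?V ` ?I) = ?V i" by blast
  have attained: "\<exists>u. ?V j = J_fin A B Q R P d x u j \<and>
      (\<forall>v. J_fin A B Q R P d x u j \<le> J_fin A B Q R P d x v j)" if "j \<in> ?I" for j
  proof -
    have "pd (Q (j k))" "pd (R (j k))" if "k < d" for k
      using Q R PiE_mem[OF \<open>j \<in> ?I\<close>, of k] that by simp_all
    then show ?thesis using V_circ_attained[of d Q j R P A B x] P by blast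
  qed
  obtain u where u: "?V i = J_fin A B Q R P d x u i"
    using attained[OF i(1)] by blast
  show thesis
  proof
    show "i \<in> {..<d} \<rightarrow> {1..M}" using i(1) by (simp add: PiE_def)
    show "V_fin M A B Q R P d x = J_fin A B Q R P d x u i"
      using i(2) u by (simp add: V_fin_def)
    fix v j
    assume j: "j \<in> {..<d} \<rightarrow> {1..M}"
    define j' where "j' = restrict j {..<d}"
    have j': "j' \<in> ?I" using j by (simp add: j'_def Pi_iff restrict_PiE_iff)
    have "J_fin A B Q R P d x u i = Min (?V ` ?I)" using i(2) u by simp
    also have "\<dots> \<le> ?V j'" using fin j' by simp
    also have "\<dots> \<le> J_fin A B Q R P d x v j'"
      using attained[OF j'] by auto
    also have "\<dots> = J_fin A B Q R P d x v j"
      by (rule J_fin_cong) (simp_all add: j'_def)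
    finally show "J_fin A B Q R P d x u i \<le> J_fin A B Q R P d x v j" .
  qed
qed

text \<open>Bellman's principle: otherwise the tail could be replaced by a cheaper one.\<close>

lemma optimal_tail:
  assumes opt: "\<And>v j. j \<in> {..<n + d} \<rightarrow> I \<Longrightarrow>
      J_fin A B Q R P (n + d) x u i \<le> J_fin A B Q R P (n + d) x v j"
    and i: "i \<in> {..<n + d} \<rightarrow> I" and j: "j \<in> {..<d} \<rightarrow> I"
  shows "J_fin A B Q R P d (sol A B n x u i) (\<lambda>l. u (n + l)) (\<lambda>l. i (n + l))
    \<le> J_fin A B Q R P d (sol A B n x u i) v j"
proof -
  have "concat_seq n i j \<in> {..<n + d} \<rightarrow> I"
    using i j by (auto simp: concat_seq_def Pi_iff)
  from opt[OF this, of "concat_seq n u v"] show ?thesis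
    by (simp add: J_fin_add[of A B Q R P n d x u i] J_fin_concat)
qed

section \<open>Consequences of dissipation\<close>

lemma J_inf_le_iff:
  assumes "\<And>k. 0 \<le> stage_cost Q R (sol A B k x u i) (u k) (i k)"
  shows "J_inf A B Q R x u i \<le> ereal r \<longleftrightarrow> (\<forall>n. running_cost A B Q R n x u i \<le> r)"
  using assms by (simp add: J_inf_def running_cost_def suminf_ereal_eq_SUP SUP_le_iff)

locale dissipative_terminal_cost =
  fixes M :: nat
    and A :: "nat \<Rightarrow> real ^ 'n ^ 'n" and B :: "nat \<Rightarrow> real ^ 'm ^ 'n"
    and Q :: "nat \<Rightarrow> real ^ 'n ^ 'n" and R :: "nat \<Rightarrow> real ^ 'm ^ 'm"
    and P :: "real ^ 'n ^ 'n"
  assumes Q_pd: "i \<in> {1..M} \<Longrightarrow> pd (Q i)"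
    and R_pd: "i \<in> {1..M} \<Longrightarrow> pd (R i)"
    and P_psd: "psd P"
    and dissipation: "i \<in> {1..M} \<Longrightarrow> y \<bullet> (P *v y) \<le>
      stage_cost Q R y u i + (A i *v y + B i *v u) \<bullet> (P *v (A i *v y + B i *v u))"
begin

lemma stage_cost_ge: "i \<in> {1..M} \<Longrightarrow> y \<bullet> (Q i *v y) \<le> stage_cost Q R y u i"
  by (simp add: stage_cost_def pd_nonneg R_pd)

lemma stage_cost_nonneg: "i \<in> {1..M} \<Longrightarrow> 0 \<le> stage_cost Q R y u i"
  by (simp add: stage_cost_def pd_nonneg Q_pd R_pd)

lemma terminal_cost_nonneg: "0 \<le> y \<bullet> (P *v y)"
  using P_psd by (simp add: psd_def)

lemma J_fin_Suc_ge:
  assumes "i n \<in> {1..M}"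
  shows "J_fin A B Q R P n y u i \<le> J_fin A B Q R P (Suc n) y u i"
  using dissipation[OF assms, of "sol A B n y u i" "u n"] by (simp add: J_fin_def)

lemma J_fin_mono:
  assumes "i \<in> {..<n} \<rightarrow> {1..M}" and "m \<le> n"
  shows "J_fin A B Q R P m y u i \<le> J_fin A B Q R P n y u i"
  using assms(2,1)
proof (induction rule: dec_induct)
  case (step k)
  then have "J_fin A B Q R P m y u i \<le> J_fin A B Q R P k y u i" by (auto simp: Pi_iff)
  also have "\<dots> \<le> J_fin A B Q R P (Suc k) y u i"
    using step.prems by (intro J_fin_Suc_ge) auto
  finally show ?case .
qed simp

lemma terminal_cost_le_J_fin:
  "i \<in> {..<d} \<rightarrow> {1..M} \<Longrightarrow> y \<bullet> (P *v y) \<le> J_fin A B Q R P d y u i"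
  using J_fin_mono[of i d 0 y u] by (simp add: J_fin_def)

text \<open>
  The stage costs are summable, hence tend to zero. The uniform bound \<open>S \<preceq> Q i\<close>
  makes the states tend to zero as well, although the mode \<open>i\<close> may switch forever. Then so
  does the terminal cost, and the total cost increases with the horizon to at most \<open>r\<close>.
\<close>

lemma J_fin_le_cost_bound:
  assumes S: "pd S" "\<And>i. i \<in> {1..M} \<Longrightarrow> S \<preceq> Q i"
    and i: "\<And>k. i k \<in> {1..M}" and bound: "\<And>n. running_cost A B Q R n y u i \<le> r"
  shows "J_fin A B Q R P d y u i \<le> r"
proof -
  let ?x = "\<lambda>k. sol A B k y u i"
  let ?l = "\<lambda>k. stage_cost Q R (?x k) (u k) (i k)"
  obtain c where c: "c > 0" "\<And>v. c * (norm v)\<^sup>2 \<le> v \<bullet> (S *v v)"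
    using pd_lower_bound[OF S(1)] by blast
  have "summable ?l"
    using stage_cost_nonneg[OF i] bound
    by (intro summableI_nonneg_bounded) (auto simp: running_cost_def)
  then have "?l \<longlonglongrightarrow> 0" by (rule summable_LIMSEQ_zero)
  then have l_0: "(\<lambda>k. ?l k / c) \<longlonglongrightarrow> 0" by (rule tendsto_divide_zero)
  have le: "norm ((norm (?x k))\<^sup>2) \<le> ?l k / c" for k
    using c(2)[of "?x k"] loewner_leD[OF S(2)[OF i], of "?x k" k]
      stage_cost_ge[OF i, of "?x k" k "u k"] c(1) by (simp add: field_simps)
  have "(\<lambda>k. (norm (?x k))\<^sup>2) \<longlonglongrightarrow> 0"
    using always_eventually[OF allI, OF le] l_0 by (rule Lim_null_comparison)
  then have "(\<lambda>k. sqrt ((norm (?x k))\<^sup>2)) \<longlonglongrightarrow> sqrt 0" by (rule tendsto_real_sqrt)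
  then have x_0: "?x \<longlonglongrightarrow> 0" by (simp add: tendsto_norm_zero_iff)
  have "continuous_on UNIV (\<lambda>v. v \<bullet> (P *v v))"
    by (intro continuous_on_quadratic continuous_on_id)
  then have "(\<lambda>k. ?x k \<bullet> (P *v ?x k)) \<longlonglongrightarrow> 0 \<bullet> (P *v 0)"
    using x_0 by (rule continuous_on_tendsto_compose) auto
  then have "(\<lambda>k. r + ?x k \<bullet> (P *v ?x k)) \<longlonglongrightarrow> r + 0"
    by (intro tendsto_add) simp_all
  moreover have "J_fin A B Q R P d y u i \<le> r + ?x k \<bullet> (P *v ?x k)" if "k \<ge> d" for k
  proof -
    have "J_fin A B Q R P d y u i \<le> J_fin A B Q R P k y u i"
      using i that by (intro J_fin_mono) auto
    then show ?thesis using bound[of k] by (simp add: J_fin_running_cost)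
  qed
  ultimately show ?thesis
    by (intro LIMSEQ_le_const[of _ "r"]) auto
qed

text \<open>
  A tail of optimal inputs is optimal. If it starts at \<open>y\<close>, it therefore costs at most
  \<open>y \<bullet> (U *v y)\<close>, hence at most \<open>1 / \<alpha>\<close> times its first stage cost. Each step thus removes at
  least the fraction \<open>\<alpha>\<close> of the remaining cost.
\<close>

lemma tail_cost_decay:
  assumes U: "\<And>y. \<exists>v j. (\<forall>k. j k \<in> {1..M}) \<and> (\<forall>n. running_cost A B Q R n y v j \<le> y \<bullet> (U *v y))"
    and "pd U" and \<alpha>: "0 < \<alpha>" "\<alpha> < 1" "\<And>i. i \<in> {1..M} \<Longrightarrow> \<alpha> *\<^sub>R U \<preceq> Q i"
    and i: "i \<in> {..<n + d} \<rightarrow> {1..M}"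
    and opt: "\<And>v j. j \<in> {..<n + d} \<rightarrow> {1..M} \<Longrightarrow>
      J_fin A B Q R P (n + d) x u i \<le> J_fin A B Q R P (n + d) x v j"
  shows "J_fin A B Q R P d (sol A B n x u i) (\<lambda>l. u (n + l)) (\<lambda>l. i (n + l))
    \<le> (1 - \<alpha>) ^ n * (x \<bullet> (U *v x))"
proof -
  define T where "T k = J_fin A B Q R P (n + d - k) (sol A B k x u i) (\<lambda>l. u (k + l)) (\<lambda>l. i (k + l))"
    for k
  have T_le: "T k \<le> sol A B k x u i \<bullet> (U *v sol A B k x u i)" if "k \<le> n" for k
  proof -
    let ?y = "sol A B k x u i"
    obtain v j where j: "\<And>l. j l \<in> {1..M}"
      and run: "\<And>N. running_cost A B Q R N ?y v j \<le> ?y \<bullet> (U *v ?y)"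
      using U[of ?y] by blast
    have "T k \<le> J_fin A B Q R P (n + d - k) ?y v j"
      unfolding T_def
      by (rule optimal_tail[where I = "{1..M}"]) (use opt i j that in auto)
    also have "\<dots> \<le> ?y \<bullet> (U *v ?y)"
    proof (rule J_fin_le_cost_bound[OF _ \<alpha>(3) j run])
      show "pd (\<alpha> *\<^sub>R U)"
        using \<open>pd U\<close> \<alpha>(1) by (simp add: pd_def transpose_scalar scaleR_matrix_vector_assoc[symmetric])
    qed
    finally show ?thesis .
  qed
  have T_Suc: "T (Suc k) \<le> (1 - \<alpha>) * T k" if "k < n" for k
  proof -
    let ?y = "sol A B k x u i"
    have ik: "i k \<in> {1..M}" using i that by (auto simp: Pi_iff)
    have "n + d - k = 1 + (n + d - Suc k)" using that by simp
    then have "T k = stage_cost Q R ?y (u k) (i k) + T (Suc k)"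
      unfolding T_def by (simp add: J_fin_add[of _ _ _ _ _ 1, simplified] running_cost_def)
    moreover have "\<alpha> * T k \<le> stage_cost Q R ?y (u k) (i k)"
    proof -
      have "\<alpha> * T k \<le> \<alpha> * (?y \<bullet> (U *v ?y))"
        using T_le[of k] that \<alpha>(1) by (intro mult_left_mono) auto
      also have "\<dots> \<le> ?y \<bullet> (Q (i k) *v ?y)"
        using loewner_leD[OF \<alpha>(3)[OF ik], of ?y]
        by (simp add: scaleR_matrix_vector_assoc[symmetric])
      also have "\<dots> \<le> stage_cost Q R ?y (u k) (i k)" by (rule stage_cost_ge[OF ik])
      finally show ?thesis .
    qed
    ultimately show ?thesis by (simp add: algebra_simps)
  qed
  have "T k \<le> (1 - \<alpha>) ^ k * (x \<bullet> (U *v x))" if "k \<le> n" for k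
    using that
  proof (induction k)
    case 0
    then show ?case using T_le[of 0] by simp
  next
    case (Suc k)
    have "T (Suc k) \<le> (1 - \<alpha>) * T k" using Suc.prems by (intro T_Suc) simp
    also have "\<dots> \<le> (1 - \<alpha>) * ((1 - \<alpha>) ^ k * (x \<bullet> (U *v x)))"
      using Suc \<alpha>(2) by (intro mult_left_mono) auto
    finally show ?case by (simp add: mult.assoc)
  qed
  from this[of n] show ?thesis by (simp add: T_def)
qed

text \<open>
  One admissible strategy is to follow \<open>u\<close>, \<open>i\<close> for \<open>n\<close> steps and then to switch to inputs
  whose cost is at most \<open>r\<close>.
\<close>

lemma V_inf_le_switch:
  assumes i: "i \<in> {..<n} \<rightarrow> {1..M}" and j: "\<And>k. j k \<in> {1..M}"
    and bound: "\<And>N. running_cost A B Q R N (sol A B n x u i) v j \<le> r"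
  shows "V_inf M A B Q R x \<le> ereal (running_cost A B Q R n x u i + r)"
proof -
  let ?u = "concat_seq n u v" and ?i = "concat_seq n i j"
  have modes: "?i k \<in> {1..M}" for k
    using i j by (cases "k < n") (auto simp: concat_seq_def Pi_iff)
  have cost_nonneg: "0 \<le> stage_cost Q R (sol A B k x ?u ?i) (?u k) (?i k)" for k
    by (rule stage_cost_nonneg[OF modes])
  have "V_inf M A B Q R x \<le> J_inf A B Q R x ?u ?i"
    unfolding V_inf_def using modes by (intro INF_lower2[of "(?u, ?i)"]) auto
  also have "\<dots> \<le> ereal (running_cost A B Q R n x u i + r)"
  proof (subst J_inf_le_iff[OF cost_nonneg], intro allI)
    fix N
    have "running_cost A B Q R N x ?u ?i \<le> running_cost A B Q R (n + N) x ?u ?i"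
      unfolding running_cost_def using cost_nonneg by (intro sum_mono2) auto
    also have "\<dots> \<le> running_cost A B Q R n x u i + r"
      using bound by (simp add: running_cost_concat)
    finally show "running_cost A B Q R N x ?u ?i \<le> running_cost A B Q R n x u i + r" .
  qed
  finally show ?thesis .
qed

end

section \<open>The gap between the two values\<close>

theorem theorem2:
  fixes M :: nat
    and A :: "nat \<Rightarrow> real ^ 'n ^ 'n" and B :: "nat \<Rightarrow> real ^ 'm ^ 'n"
    and Q :: "nat \<Rightarrow> real ^ 'n ^ 'n" and R :: "nat \<Rightarrow> real ^ 'm ^ 'm"
    and P_low P_up :: "real ^ 'n ^ 'n"
    and \<alpha> \<alpha>\<^sub>0 :: real and d :: nat and x :: "real ^ 'n"
  assumes "M > 0"
    and "\<And>i. i \<in> {1..M} \<Longrightarrow> pd (Q i)"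
    and "\<And>i. i \<in> {1..M} \<Longrightarrow> pd (R i)"
    and "psd P_low"
    and "\<And>i. i \<in> {1..M} \<Longrightarrow>
      psd (block_matrix
        (transpose (A i) ** P_low ** A i - P_low + Q i)  (transpose (A i) ** P_low ** B i)
        (transpose (B i) ** P_low ** A i)  (R i + transpose (B i) ** P_low ** B i))"
    and "pd P_up"
    and "\<And>y. \<exists>u. \<exists>i \<in> UNIV \<rightarrow> {1..M}.
      V_inf M A B Q R y = J_inf A B Q R y u i \<and> J_inf A B Q R y u i \<le> ereal (y \<bullet> (P_up *v y))"
    and "0 < \<alpha>" and "\<alpha> < 1" and "\<alpha>\<^sub>0 > 0"
    and "\<And>i. i \<in> {1..M} \<Longrightarrow> \<alpha> *\<^sub>R P_up \<preceq> Q i"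
    and "\<And>i. i \<in> {1..M} \<Longrightarrow> \<alpha>\<^sub>0 *\<^sub>R (P_up - P_low) \<preceq> Q i"
    and "d > 1"
  shows "V_inf M A B Q R x - ereal (V_fin M A B Q R P_low d x)
    \<le> ereal (1 / \<alpha>\<^sub>0 * (1 - \<alpha>) ^ (d - 1) * (x \<bullet> (P_up *v x)))"
proof -
  obtain n where d: "d = Suc n" using \<open>d > 1\<close> by (cases d) auto
  interpret dissipative_terminal_cost M A B Q R P_low
  proof
    show "y \<bullet> (P_low *v y) \<le>
        stage_cost Q R y u i + (A i *v y + B i *v u) \<bullet> (P_low *v (A i *v y + B i *v u))"
      if "i \<in> {1..M}" for i y u
      by (rule block_psd_dissipation[where A = A and B = B and Q = Q and R = R and i = i and P = P_low,
            OF assms(5)[OF that]])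
  qed (fact assms(2), fact assms(3), fact assms(4))
  let ?q = "\<lambda>y. y \<bullet> (P_up *v y)" and ?p = "\<lambda>y. y \<bullet> (P_low *v y)"
  have bounded: "\<exists>v j. (\<forall>k. j k \<in> {1..M}) \<and> (\<forall>n. running_cost A B Q R n y v j \<le> ?q y)" for y
  proof -
    obtain v j where j: "j \<in> UNIV \<rightarrow> {1..M}" and le: "J_inf A B Q R y v j \<le> ereal (?q y)"
      using assms(7)[of y] by blast
    have modes: "j k \<in> {1..M}" for k using j by blast
    then have "\<forall>n. running_cost A B Q R n y v j \<le> ?q y"
      using le by (subst (asm) J_inf_le_iff) (auto intro: stage_cost_nonneg)
    then show ?thesis using modes by blast
  qed
  obtain u i where i: "i \<in> {..<d} \<rightarrow> {1..M}"
    and V: "V_fin M A B Q R P_low d x = J_fin A B Q R P_low d x u i"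
    and opt: "\<And>v j. j \<in> {..<d} \<rightarrow> {1..M} \<Longrightarrow>
      J_fin A B Q R P_low d x u i \<le> J_fin A B Q R P_low d x v j"
    by (rule V_fin_attained[where M = M and A = A and B = B and Q = Q and R = R and P = P_low
          and d = d and x = x, OF \<open>M > 0\<close> _ _ \<open>psd P_low\<close>])
      (rule assms(2), assumption, rule assms(3), assumption, rule that)
  define y where "y = sol A B n x u i"
  define T where "T = J_fin A B Q R P_low 1 y (\<lambda>l. u (n + l)) (\<lambda>l. i (n + l))"
  have V_split: "V_fin M A B Q R P_low d x = running_cost A B Q R n x u i + T"
    using V J_fin_add[of A B Q R P_low n 1 x u i] by (simp add: d T_def y_def)
  have decay: "T \<le> (1 - \<alpha>) ^ n * ?q x"
    unfolding T_def y_def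
    by (rule tail_cost_decay[where i = i, OF bounded \<open>pd P_up\<close> \<open>0 < \<alpha>\<close> \<open>\<alpha> < 1\<close> assms(11)])
      (use i opt in \<open>simp_all add: d\<close>)
  have i_n: "i n \<in> {1..M}" using i d by auto
  have "?p y \<le> T"
    unfolding T_def by (rule terminal_cost_le_J_fin) (use i_n in auto)
  have "\<alpha>\<^sub>0 * (?q y - ?p y) \<le> y \<bullet> (Q (i n) *v y)"
    using loewner_leD[OF assms(12)[OF i_n], of y]
    by (simp add: scaleR_matrix_vector_assoc[symmetric] matrix_vector_mult_diff_rdistrib
        inner_diff_right)
  also have "\<dots> \<le> stage_cost Q R y (u n) (i n)" by (rule stage_cost_ge[OF i_n])
  also have "\<dots> \<le> T"
    unfolding T_def by (simp add: J_fin_def terminal_cost_nonneg)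
  finally have "?q y - ?p y \<le> 1 / \<alpha>\<^sub>0 * T"
    using \<open>\<alpha>\<^sub>0 > 0\<close> by (simp add: field_simps)
  also have "\<dots> \<le> 1 / \<alpha>\<^sub>0 * ((1 - \<alpha>) ^ n * ?q x)"
    using decay \<open>\<alpha>\<^sub>0 > 0\<close> by (intro mult_left_mono) auto
  finally have gap: "?q y - T \<le> 1 / \<alpha>\<^sub>0 * (1 - \<alpha>) ^ (d - 1) * ?q x"
    using \<open>?p y \<le> T\<close> by (simp add: d)
  obtain v j where j: "\<And>k. j k \<in> {1..M}" and run: "\<And>N. running_cost A B Q R N y v j \<le> ?q y"
    using bounded[of y] by blast
  have i': "i \<in> {..<n} \<rightarrow> {1..M}" using i d by (simp add: Pi_iff)
  have "V_inf M A B Q R x \<le> ereal (running_cost A B Q R n x u i + ?q y)"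
    by (rule V_inf_le_switch[OF i' j run[unfolded y_def], folded y_def])
  then have "V_inf M A B Q R x - ereal (V_fin M A B Q R P_low d x)
      \<le> ereal (running_cost A B Q R n x u i + ?q y) - ereal (V_fin M A B Q R P_low d x)"
    by (rule ereal_minus_mono) simp
  also have "\<dots> = ereal (?q y - T)" by (simp add: V_split)
  also have "\<dots> \<le> ereal (1 / \<alpha>\<^sub>0 * (1 - \<alpha>) ^ (d - 1) * ?q x)"
    using gap by simp
  finally show ?thesis .
qed

end
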